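(* For every finite directed graph $G(V,E)$ and every prime power $q\ge2$, $$\mathbb{CAP}_q(G)\le \mathrm{FVS}(G),$$ where $\mathrm{FVS}(G)$ is the minimum number of vertices whose removal makes $G$ acyclic (i.e. without directed cycles).
   Context: Write $V=\{1,\dots,n\}$ and, for $i\in V$, let $N(i)=\{u\in V:(i,u)\in E\}$ (out-neighbours). For $X\in\mathbb{F}_q^n$ and $I\subseteq V$, $X_I\in\mathbb{F}_q^{|I|}$ denotes the projection onto the coordinates in $I$. An RDSS (recoverable distributed storage system) code for $G$ is a set $\mathcal{C}\subseteq\mathbb{F}_q^n$ for which there are deterministic functions $f_i:\mathbb{F}_q^{|N(i)|}\to\mathbb{F}_q$, $i=1,\dots,n$, with $X_i=f_i(X_{N(i)})$ for all $X\in\mathcal{C}$ and all $i$. Its dimension is $\log_q|\mathcal{C}|$. $\mathbb{CAP}_q(G)$ denotes the maximum dimension of an RDSS code over $\mathbb{F}_q$ for $G$. *)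

theory Defs
  imports
    Complex_Main
    "HOL-Library.FuncSet"
    "HOL-Algebra.Ring"
    "HOL-Algebra.Coset"
    "HOL-Number_Theory.Prime_Powers"
    "Graph_Theory.Pair_Digraph"
    "Graph_Theory.Digraph_Component"
begin

definition out_nbrs :: "'a pair_pre_digraph \<Rightarrow> 'a \<Rightarrow> 'a set" where
  "out_nbrs G i = {u \<in> pverts G. (i, u) \<in> parcs G}"

text \<open>
  A word over \<open>F\<close> indexed by a finite set \<open>I\<close> is an element of \<open>I \<rightarrow>\<^sub>E carrier F\<close>; such functions
  take the value \<open>undefined\<close> outside \<open>I\<close>, so this is exactly the set of \<open>I\<close>-tuples over \<open>F\<close>.
  The projection of \<open>X\<close> onto the coordinates in \<open>I\<close> is \<open>restrict X I\<close>.
\<close>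

definition rdss_code ::
    "('b, 'm) ring_scheme \<Rightarrow> 'a pair_pre_digraph \<Rightarrow> ('a \<Rightarrow> 'b) set \<Rightarrow> bool" where
  "rdss_code F G C \<longleftrightarrow>
     C \<subseteq> (pverts G \<rightarrow>\<^sub>E carrier F) \<and>
     (\<exists>f. (\<forall>i \<in> pverts G. f i \<in> (out_nbrs G i \<rightarrow>\<^sub>E carrier F) \<rightarrow> carrier F) \<and>
          (\<forall>X \<in> C. \<forall>i \<in> pverts G. X i = f i (restrict X (out_nbrs G i))))"

definition code_dim :: "('b, 'm) ring_scheme \<Rightarrow> ('a \<Rightarrow> 'b) set \<Rightarrow> real" where
  "code_dim F C = log (real (order F)) (real (card C))"

text \<open>
  The empty code, whose dimension would be \<open>log 0\<close>, is left out of the maximum.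
\<close>

definition CAP :: "('b, 'm) ring_scheme \<Rightarrow> 'a pair_pre_digraph \<Rightarrow> real" where
  "CAP F G = Max {code_dim F C | C. rdss_code F G C \<and> C \<noteq> {}}"

text \<open>
  A loop is a directed cycle of length one.
\<close>

definition acyclic_digraph :: "('a, 'e) pre_digraph \<Rightarrow> bool" where
  "acyclic_digraph G \<longleftrightarrow> \<not> (\<exists>p. pre_digraph.cycle G p)"

definition remove_verts :: "'a pair_pre_digraph \<Rightarrow> 'a set \<Rightarrow> ('a, 'a \<times> 'a) pre_digraph" where
  "remove_verts G S = induce_subgraph (with_proj G) (pverts G - S)"

definition FVS :: "'a pair_pre_digraph \<Rightarrow> nat" where
  "FVS G = Min {card S | S. S \<subseteq> pverts G \<and> acyclic_digraph (remove_verts G S)}"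

text \<open>
  The maximum and the minimum above range over finite nonempty sets.
\<close>

lemma CAP_well_defined:
  assumes "finite (pverts G)" "finite (carrier F)" "carrier F \<noteq> {}"
  shows "finite {code_dim F C | C. rdss_code F G C \<and> C \<noteq> {}}"
    and "{code_dim F C | C. rdss_code F G C \<and> C \<noteq> {}} \<noteq> {}"
proof -
  have "{code_dim F C | C. rdss_code F G C \<and> C \<noteq> {}} \<subseteq>
      code_dim F ` Pow (pverts G \<rightarrow>\<^sub>E carrier F)"
    by (auto simp: rdss_code_def)
  then show "finite {code_dim F C | C. rdss_code F G C \<and> C \<noteq> {}}"
    by (rule finite_subset) (simp add: assms finite_PiE)
  obtain a where "a \<in> carrier F"
    using assms by blast
  then have "rdss_code F G {\<lambda>i \<in> pverts G. a}"
    unfolding rdss_code_def by (auto intro!: exI[of _ "\<lambda>i x. a"])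
  then show "{code_dim F C | C. rdss_code F G C \<and> C \<noteq> {}} \<noteq> {}"
    by blast
qed

lemma FVS_well_defined:
  assumes "finite (pverts G)"
  shows "finite {card S | S. S \<subseteq> pverts G \<and> acyclic_digraph (remove_verts G S)}"
    and "{card S | S. S \<subseteq> pverts G \<and> acyclic_digraph (remove_verts G S)} \<noteq> {}"
proof -
  show "finite {card S | S. S \<subseteq> pverts G \<and> acyclic_digraph (remove_verts G S)}"
    using assms by simp
  have "acyclic_digraph (remove_verts G (pverts G))"
    by (auto simp: acyclic_digraph_def remove_verts_def pre_digraph.cycle_def
        pre_digraph.awalk_def)
  then show "{card S | S. S \<subseteq> pverts G \<and> acyclic_digraph (remove_verts G S)} \<noteq> {}"
    by blast
qed

end

theory Submission
  imports Defs
begin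

text \<open>
  Let \<open>S\<close> be a feedback vertex set. Outside \<open>S\<close> the arc relation is well-founded along
  out-neighbours, so the recovery functions determine every coordinate of a codeword from its
  coordinates in \<open>S\<close>. Projection to \<open>S\<close> is therefore injective on the code, which has at most
  \<open>q ^ card S\<close> elements.
\<close>

text \<open>A pair \<open>(u, u)\<close> in the transitive closure comes from a nonempty closed
  walk, and every such walk contains a cycle. This turns the absence of cycles into a property of a
  relation, from which well-foundedness can be derived.\<close>

lemma (in wf_digraph) acyclic_arcs_ends:
  assumes "acyclic_digraph G"
  shows "acyclic (arcs_ends G)"
proof (rule acyclicI, rule allI, rule notI)
  fix u assume "(u, u) \<in> (arcs_ends G)\<^sup>+"
  then obtain p where "awalk u p u" "p \<noteq> []"
    using reachable1_awalk by blast
  then have "closed_w p"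
    by (auto simp: closed_w_def)
  then show False
    using closed_w_imp_cycle assms by (auto simp: acyclic_digraph_def)
qed

lemma rdss_code_inj_on_feedback_set:
  assumes fin: "pair_fin_digraph G"
    and code: "rdss_code F G C"
    and S: "S \<subseteq> pverts G" "acyclic_digraph (remove_verts G S)"
  shows "inj_on (\<lambda>X. restrict X S) C"
proof (rule inj_onI)
  interpret pair_fin_digraph G by (rule fin)
  let ?R = "arcs_ends (remove_verts G S)"
  have "wf_digraph (remove_verts G S)"
    unfolding remove_verts_def by (rule wellformed_induce_subgraph)
  then have "acyclic ?R"
    using S(2) by (rule wf_digraph.acyclic_arcs_ends)
  moreover have R: "?R = {(i, u) \<in> parcs G. i \<in> pverts G - S \<and> u \<in> pverts G - S}"
    by (force simp: remove_verts_def arcs_ends_def arc_to_ends_def)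
  moreover have "finite {(i, u) \<in> parcs G. i \<in> pverts G - S \<and> u \<in> pverts G - S}"
    by (rule finite_subset[OF _ pair_finite_arcs]) auto
  \<comment> \<open>The converse is taken because the induction must descend from a vertex to its
    out-neighbours: \<open>(u, i)\<close> lies in it iff the arc from \<open>i\<close> to
    \<open>u\<close> survives the removal of \<open>S\<close>. Finiteness makes acyclicity
    sufficient.\<close>
  ultimately have wf: "wf (?R\<inverse>)"
    by (metis finite_acyclic_wf_converse)
  obtain f where f: "\<And>X i. X \<in> C \<Longrightarrow> i \<in> pverts G \<Longrightarrow> X i = f i (restrict X (out_nbrs G i))"
    and words: "C \<subseteq> pverts G \<rightarrow>\<^sub>E carrier F"
    using code unfolding rdss_code_def by blast
  fix X Y assume X: "X \<in> C" and Y: "Y \<in> C" and eq: "restrict X S = restrict Y S"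
  have "i \<in> pverts G \<Longrightarrow> X i = Y i" for i
    using wf
  proof (induction i rule: wf_induct_rule)
    case (less i)
    show ?case
    proof (cases "i \<in> S")
      case True
      then show ?thesis using eq by (metis restrict_apply')
    next
      case False
      \<comment> \<open>An out-neighbour in \<open>S\<close> is covered by \<open>eq\<close>. One
        outside \<open>S\<close> is the head of a surviving arc, since \<open>i\<close> is outside
        \<open>S\<close> too, so the induction hypothesis applies.\<close>
      have "X u = Y u" if u: "u \<in> out_nbrs G i" for u
      proof (cases "u \<in> S")
        case True
        then show ?thesis using eq by (metis restrict_apply')
      next
        assume "u \<notin> S"
        with False u less.prems show ?thesis
          by (intro less.IH) (auto simp: R out_nbrs_def)
      qed
      then have "restrict X (out_nbrs G i) = restrict Y (out_nbrs G i)"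
        by (rule restrict_ext)
      then show ?thesis
        using f X Y less.prems by metis
    qed
  qed
  \<comment> \<open>Both words are \<open>undefined\<close> outside \<open>pverts G\<close>, so
    agreement on the vertices is equality of functions.\<close>
  then show "X = Y"
    using words X Y by (intro PiE_ext[of X "pverts G" "\<lambda>_. carrier F" Y]) auto
qed

lemma rdss_code_dim_le_feedback_set:
  assumes fin: "pair_fin_digraph G"
    and q: "order F > 1"
    and code: "rdss_code F G C" "C \<noteq> {}"
    and S: "S \<subseteq> pverts G" "acyclic_digraph (remove_verts G S)"
  shows "code_dim F C \<le> card S"
proof -
  interpret pair_fin_digraph G by (rule fin)
  have finS: "finite S"
    using S(1) pair_finite_verts by (rule finite_subset)
  \<comment> \<open>An infinite carrier would have \<open>order F = 0\<close>.\<close>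
  have finF: "finite (carrier F)"
    using q by (auto simp: order_def intro: card_ge_0_finite)
  have words: "C \<subseteq> pverts G \<rightarrow>\<^sub>E carrier F"
    using code(1) by (simp add: rdss_code_def)
  then have "finite C"
    by (rule finite_subset) (simp add: finite_PiE finF)
  \<comment> \<open>Comparing logarithms below requires a positive argument, hence a nonempty
    code.\<close>
  then have pos: "card C > 0"
    using code(2) by (simp add: card_gt_0_iff)
  have "(\<lambda>X. restrict X S) ` C \<subseteq> S \<rightarrow>\<^sub>E carrier F"
    using words S(1) by (auto simp: PiE_iff subset_iff)
  then have "card C \<le> card (S \<rightarrow>\<^sub>E carrier F)"
    using rdss_code_inj_on_feedback_set[OF fin code(1) S]
    by (intro card_inj_on_le) (auto simp: finite_PiE finS finF)
  also have "\<dots> = order F ^ card S"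
    by (simp add: card_funcsetE finS order_def)
  finally have "real (card C) \<le> real (order F) ^ card S"
    by (metis of_nat_le_iff of_nat_power)
  then have "log (order F) (card C) \<le> log (order F) (real (order F) ^ card S)"
    using pos q by (subst log_le_cancel_iff) auto
  also have "\<dots> = card S"
    using q by (simp add: log_nat_power)
  finally show ?thesis
    by (simp add: code_dim_def)
qed

theorem proposition11:
  fixes G :: "'a pair_pre_digraph"
    and F :: "('b, 'm) ring_scheme"
    and q :: nat
  assumes "pair_fin_digraph G"
    and "primepow q"
    and "field F"
    and "order F = q"
  shows "CAP F G \<le> real (FVS G)"
proof -
  interpret pair_fin_digraph G by (rule assms(1))
  have q: "order F > 1"
    using assms(2,4) primepow_gt_Suc_0 by auto
  then have F: "finite (carrier F)" "carrier F \<noteq> {}"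
    by (auto simp: order_def intro: card_ge_0_finite)
  \<comment> \<open>Both extrema are attained, so it suffices to compare one minimum feedback set
    with one code of maximum dimension.\<close>
  obtain S where S: "S \<subseteq> pverts G" "acyclic_digraph (remove_verts G S)" "FVS G = card S"
    using Min_in[OF FVS_well_defined[OF pair_finite_verts]] unfolding FVS_def by blast
  obtain C where C: "rdss_code F G C" "C \<noteq> {}" "CAP F G = code_dim F C"
    using Max_in[OF CAP_well_defined[OF pair_finite_verts F]] unfolding CAP_def by blast
  show ?thesis
    using rdss_code_dim_le_feedback_set[OF assms(1) q C(1,2) S(1,2)] C(3) S(3) by simp
qed

end
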